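(* Let $L$ be a finite-dimensional nilpotent restricted Lie algebra over a perfect field of characteristic $p>0$ with $p\neq 2$. Then every restricted subalgebra of $L$ is a restricted quasi-ideal of $L$ if and only if $L=S\oplus P$, where $S$ is a toral ideal and $P$ is a $p$-nilpotent ideal in which every restricted subalgebra is a restricted quasi-ideal (of $P$).
   Context: All algebras are finite-dimensional. A restricted subalgebra $S$ of a restricted Lie algebra $L$ is a restricted quasi-ideal of $L$ if $[S,H]\subseteq S+H$ for all restricted subalgebras $H$ of $L$. For a subset $X$ of $L$, $\langle X\rangle_p$ denotes the restricted subalgebra generated by $X$. An element $x$ is semisimple if $x\in\langle x^{[p]}\rangle_p$; a torus is an abelian restricted Lie algebra consisting of semisimple elements, and a toral ideal is a restricted ideal that is a torus. A restricted Lie algebra $P$ is $p$-nilpotent if there is $n>0$ with $x^{[p]^n}=0$ for every $x\in P$; a $p$-nilpotent ideal is a restricted ideal that is $p$-nilpotent. $\oplus$ denotes algebra direct sum. *)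

theory Defs
  imports
    "HOL-Computational_Algebra.Computational_Algebra"
    "HOL-Library.Set_Algebras"
begin

definition perfect_field :: "'k::field itself \<Rightarrow> bool" where
  "perfect_field _ \<longleftrightarrow> CHAR('k) = 0 \<or> surj (\<lambda>a::'k. a ^ CHAR('k))"

text \<open>
  The algebra \<open>L\<close> is the whole type \<open>'v\<close>. Its subalgebras and ideals are subsets, and notions
  relative to such a subset take it as an explicit argument.
\<close>

locale lie_algebra = vector_space scale
  for scale :: "'k::field \<Rightarrow> 'v::ab_group_add \<Rightarrow> 'v" +
  fixes bracket :: "'v \<Rightarrow> 'v \<Rightarrow> 'v"
  assumes bracket_add_left: "bracket (x + y) z = bracket x z + bracket y z"
    and bracket_add_right: "bracket x (y + z) = bracket x y + bracket x z"
    and bracket_scale_left: "bracket (scale a x) y = scale a (bracket x y)"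
    and bracket_scale_right: "bracket x (scale a y) = scale a (bracket x y)"
    and bracket_self: "bracket x x = 0"
    and jacobi: "bracket x (bracket y z) + bracket y (bracket z x) + bracket z (bracket x y) = 0"
begin

definition lie_product :: "'v set \<Rightarrow> 'v set \<Rightarrow> 'v set" where
  "lie_product A B = span {bracket a b | a b. a \<in> A \<and> b \<in> B}"

primrec lower_central :: "nat \<Rightarrow> 'v set" where
  "lower_central 0 = UNIV"
| "lower_central (Suc n) = lie_product UNIV (lower_central n)"

definition lie_nilpotent :: bool where
  "lie_nilpotent \<longleftrightarrow> (\<exists>n. lower_central n = {0})"

text \<open>Internal direct sum of algebras: a direct sum of subspaces that commute with each other.\<close>

definition lie_direct_sum :: "'v set \<Rightarrow> 'v set \<Rightarrow> 'v set \<Rightarrow> bool" where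
  "lie_direct_sum M A B \<longleftrightarrow>
     subspace A \<and> subspace B \<and> M = A + B \<and> A \<inter> B = {0} \<and> lie_product A B = {0}"

text \<open>
  Polynomials with coefficients in \<open>'v\<close> represent the elements of \<open>L \<otimes> k[X]\<close>, and \<open>ad_pencil x y\<close>
  is the map \<open>ad (x \<otimes> X + y \<otimes> 1)\<close> on them. The elements \<open>s\<^sub>i(x,y)\<close> of Jacobson's formula are given by
  \<open>(ad (x \<otimes> X + y \<otimes> 1))\<^sup>p\<^sup>-\<^sup>1 (x \<otimes> 1) = (\<Sum>i = 1..p - 1. i s\<^sub>i(x,y) \<otimes> X\<^sup>i\<^sup>-\<^sup>1)\<close>.
\<close>

definition ad_pencil :: "'v \<Rightarrow> 'v \<Rightarrow> 'v poly \<Rightarrow> 'v poly" where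
  "ad_pencil x y f = pCons 0 (map_poly (bracket x) f) + map_poly (bracket y) f"

definition jacobson_term :: "nat \<Rightarrow> 'v \<Rightarrow> 'v \<Rightarrow> 'v" where
  "jacobson_term i x y =
     scale (inverse (of_nat i)) (coeff ((ad_pencil x y ^^ (CHAR('k) - 1)) [:x:]) (i - 1))"

end

locale restricted_lie_algebra = lie_algebra scale bracket
  for scale :: "'k::field \<Rightarrow> 'v::ab_group_add \<Rightarrow> 'v" and bracket :: "'v \<Rightarrow> 'v \<Rightarrow> 'v" +
  fixes pmap :: "'v \<Rightarrow> 'v"
  assumes char_pos: "CHAR('k) > 0"
    and bracket_pmap: "bracket (pmap x) y = (bracket x ^^ CHAR('k)) y"
    and pmap_scale: "pmap (scale a x) = scale (a ^ CHAR('k)) (pmap x)"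
    and pmap_add: "pmap (x + y) = pmap x + pmap y + (\<Sum>i = 1..CHAR('k) - 1. jacobson_term i x y)"
begin

definition restricted_subalgebra :: "'v set \<Rightarrow> bool" where
  "restricted_subalgebra S \<longleftrightarrow>
     subspace S \<and> (\<forall>x\<in>S. \<forall>y\<in>S. bracket x y \<in> S) \<and> (\<forall>x\<in>S. pmap x \<in> S)"

definition restricted_ideal :: "'v set \<Rightarrow> bool" where
  "restricted_ideal I \<longleftrightarrow>
     subspace I \<and> (\<forall>x. \<forall>y\<in>I. bracket x y \<in> I) \<and> (\<forall>x\<in>I. pmap x \<in> I)"

text \<open>\<open>S\<close> is a restricted quasi-ideal of the restricted subalgebra \<open>M\<close>.\<close>

definition restricted_quasi_ideal :: "'v set \<Rightarrow> 'v set \<Rightarrow> bool" where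
  "restricted_quasi_ideal M S \<longleftrightarrow>
     restricted_subalgebra S \<and> S \<subseteq> M \<and>
     (\<forall>H. restricted_subalgebra H \<and> H \<subseteq> M \<longrightarrow> lie_product S H \<subseteq> S + H)"

definition generated :: "'v set \<Rightarrow> 'v set" where
  "generated X = restricted_subalgebra hull X"

definition semisimple :: "'v \<Rightarrow> bool" where
  "semisimple x \<longleftrightarrow> x \<in> generated {pmap x}"

definition torus :: "'v set \<Rightarrow> bool" where
  "torus T \<longleftrightarrow>
     restricted_subalgebra T \<and> lie_product T T = {0} \<and> (\<forall>x\<in>T. semisimple x)"

definition toral_ideal :: "'v set \<Rightarrow> bool" where
  "toral_ideal I \<longleftrightarrow> restricted_ideal I \<and> torus I"

definition p_nilpotent :: "'v set \<Rightarrow> bool" where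
  "p_nilpotent P \<longleftrightarrow> restricted_subalgebra P \<and> (\<exists>n>0. \<forall>x\<in>P. (pmap ^^ n) x = 0)"

definition p_nilpotent_ideal :: "'v set \<Rightarrow> bool" where
  "p_nilpotent_ideal I \<longleftrightarrow> restricted_ideal I \<and> p_nilpotent I"

end

end

theory Submission
  imports Defs
begin

text \<open>
  In a nilpotent \<open>L\<close> every sufficiently high \<open>p\<close>-power is central, so semisimple elements are
  central. Over a perfect field the Fitting decomposition of the \<open>p\<close>-map on the centre then splits
  every element of \<open>L\<close> into a semisimple central part and a \<open>p\<close>-nilpotent part.

  If all restricted subalgebras are quasi-ideals and \<open>x\<close>, \<open>y\<close> are \<open>p\<close>-nilpotent, then
  \<open>H = \<langle>x\<rangle>\<^sub>p + \<langle>y\<rangle>\<^sub>p\<close> is a restricted subalgebra. For \<open>h\<close> in \<open>H\<close> a high \<open>p\<close>-power \<open>t = u + v\<close> of \<open>h\<close> is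
  semisimple, hence central, so \<open>u\<close> and \<open>v\<close> commute and \<open>t\<close>, hence \<open>h\<close>, is \<open>p\<close>-nilpotent. It
  follows that the \<open>p\<close>-nilpotent elements of \<open>L\<close> form a restricted ideal. Conversely, the semisimple
  part \<open>s\<close> of \<open>h = s + x\<close> lies in \<open>\<langle>h\<rangle>\<^sub>p\<close>, so \<open>[s + x, t + y] = [x, y] \<in> \<langle>x\<rangle>\<^sub>p + \<langle>y\<rangle>\<^sub>p \<subseteq> H + K\<close>.
\<close>

section \<open>Chains of subspaces in finite dimension\<close>

context vector_space
begin

lemma decreasing_subspaces_stabilize:
  assumes "finite_dimensional_vector_space scale B"
    and sub: "\<And>n. subspace (W n)" and dec: "\<And>n. W (Suc n) \<subseteq> W n"
  shows "\<exists>N. \<forall>n\<ge>N. W n = W N"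
proof -
  interpret finite_dimensional_vector_space scale B by fact
  obtain N where N: "\<And>n. dim (W N) \<le> dim (W n)"
    using ex_has_least_nat[of "\<lambda>_. True" 0 "\<lambda>n. dim (W n)"] by auto
  have "W n = W N" if "n \<ge> N" for n
    using lift_Suc_antimono_le[of W, OF dec that] subspace_dim_equal[OF sub sub] N by blast
  then show ?thesis by blast
qed

lemma increasing_subspaces_stabilize:
  assumes "finite_dimensional_vector_space scale B"
    and sub: "\<And>n. subspace (W n)" and inc: "\<And>n. W n \<subseteq> W (Suc n)"
  shows "\<exists>N. \<forall>n\<ge>N. W n = W N"
proof -
  interpret finite_dimensional_vector_space scale B by fact
  obtain N where N: "\<And>n. dim (W n) \<le> dim (W N)"
    using ex_has_greatest_nat[of "\<lambda>_. True" 0 "\<lambda>n. dim (W n)" "Suc (dim UNIV)"]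
    by (meson dim_subset le_imp_less_Suc top_greatest)
  have "W n = W N" if "n \<ge> N" for n
    using lift_Suc_mono_le[of W, OF inc that] subspace_dim_equal[OF sub sub] N by blast
  then show ?thesis by blast
qed

lemma subspace_set_plus: "subspace A \<Longrightarrow> subspace B \<Longrightarrow> subspace (A + B)"
proof -
  have "A + B = {a + b | a b. a \<in> A \<and> b \<in> B}"
    by (auto simp: set_plus_def)
  then show "subspace A \<Longrightarrow> subspace B \<Longrightarrow> subspace (A + B)"
    by (simp add: subspace_sums)
qed

end

section \<open>Brackets, nilpotency of ad and the centre\<close>

context lie_algebra
begin

lemma bracket_0_left [simp]: "bracket 0 x = 0"
  using bracket_add_left[of 0 0 x] by simp

lemma bracket_0_right [simp]: "bracket x 0 = 0"
  using bracket_add_right[of x 0 0] by simp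

lemma bracket_anticomm: "bracket y x = - bracket x y"
proof -
  have "bracket x y + bracket y x = 0"
    using bracket_self[of "x + y"] unfolding bracket_add_left bracket_add_right
    by (simp add: bracket_self add.commute)
  then show ?thesis
    by (metis add.commute eq_neg_iff_add_eq_0)
qed

lemma bracket_eq_0_commute: "bracket x y = 0 \<Longrightarrow> bracket y x = 0"
  by (simp add: bracket_anticomm[of y x])

lemma bracket_in_lie_product: "a \<in> A \<Longrightarrow> b \<in> B \<Longrightarrow> bracket a b \<in> lie_product A B"
  unfolding lie_product_def by (blast intro: span_base)

lemma lie_product_subset_iff:
  assumes "subspace W"
  shows "lie_product A B \<subseteq> W \<longleftrightarrow> (\<forall>a\<in>A. \<forall>b\<in>B. bracket a b \<in> W)"
proof
  show "lie_product A B \<subseteq> W" if "\<forall>a\<in>A. \<forall>b\<in>B. bracket a b \<in> W"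
    unfolding lie_product_def using that assms by (intro span_minimal) auto
qed (use bracket_in_lie_product in blast)

lemma lie_product_eq_0_iff: "lie_product A B = {0} \<longleftrightarrow> (\<forall>a\<in>A. \<forall>b\<in>B. bracket a b = 0)"
  using lie_product_subset_iff[of "{0}" A B] span_zero[of "{bracket a b |a b. a \<in> A \<and> b \<in> B}"]
  by (auto simp: lie_product_def subspace_def)

lemma ad_pow_in_lower_central: "(bracket x ^^ n) y \<in> lower_central n"
  by (induction n) (auto intro: bracket_in_lie_product)

lemma ad_pow_eq_0:
  assumes "lower_central n = {0}" "n \<le> m"
  shows "(bracket x ^^ m) y = 0"
proof -
  have zero: "(bracket x ^^ k) 0 = 0" for k
    by (induction k) auto
  have "(bracket x ^^ m) y = (bracket x ^^ (m - n)) ((bracket x ^^ n) y)"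
    using assms(2) by (metis comp_apply funpow_add le_add_diff_inverse2)
  then show ?thesis
    using ad_pow_in_lower_central[where n = n and x = x and y = y] assms(1) zero by simp
qed

definition centre :: "'v set" where
  "centre = {z. \<forall>x. bracket z x = 0}"

lemma bracket_centre_left: "z \<in> centre \<Longrightarrow> bracket z x = 0"
  by (simp add: centre_def)

lemma bracket_centre_right: "z \<in> centre \<Longrightarrow> bracket x z = 0"
  by (simp add: centre_def bracket_eq_0_commute)

lemma subspace_centre: "subspace centre"
  by (auto simp: subspace_def centre_def bracket_add_left bracket_scale_left)

text \<open>Coefficient \<open>i\<close> of \<open>ad_pencil x y f\<close> is the bracket of
  \<open>x\<close> with coefficient \<open>i - 1\<close> of \<open>f\<close> (absent for
  \<open>i = 0\<close>) plus the bracket of \<open>y\<close> with coefficient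
  \<open>i\<close>.\<close>

lemma coeff_ad_pencil_in:
  assumes "subspace H" "\<And>v. v \<in> H \<Longrightarrow> bracket x v \<in> H" "\<And>v. v \<in> H \<Longrightarrow> bracket y v \<in> H"
    and "\<And>i. coeff f i \<in> H"
  shows "coeff (ad_pencil x y f) i \<in> H"
  using assms
  by (cases i) (auto simp: ad_pencil_def coeff_map_poly coeff_pCons subspace_def)

text \<open>The coefficients arise from \<open>x\<close> by repeatedly bracketing with
  \<open>x\<close> and \<open>y\<close>. Closure of \<open>H\<close> under \<open>pmap\<close> is
  deliberately not assumed: the lemma serves to prove such a closure for sums of
  subalgebras.\<close>

lemma jacobson_term_in:
  assumes H: "subspace H" "\<And>u v. u \<in> H \<Longrightarrow> v \<in> H \<Longrightarrow> bracket u v \<in> H"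
    and "x \<in> H" "y \<in> H"
  shows "jacobson_term i x y \<in> H"
proof -
  have "coeff ((ad_pencil x y ^^ k) [:x:]) i \<in> H" for k i
  proof (induction k arbitrary: i)
    case 0
    then show ?case
      using assms by (cases i) (auto simp: subspace_0)
  next
    case (Suc k)
    then show ?case
      using coeff_ad_pencil_in[of H x y] assms by simp
  qed
  then show ?thesis
    unfolding jacobson_term_def using H(1) by (simp add: subspace_scale)
qed

end

section \<open>The \<open>p\<close>-map on commuting and on central elements\<close>

context restricted_lie_algebra
begin

lemma CHAR_ge_2: "CHAR('k) \<ge> 2"
  using char_pos CHAR_not_1[where ?'a = 'k] by linarith

lemma pmap_0 [simp]: "pmap 0 = 0"
  using pmap_scale[of 0 0] char_pos by (simp add: power_0_left)

lemma pmap_pow_0 [simp]: "(pmap ^^ n) 0 = 0"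
  by (induction n) auto

lemma pmap_pow_eq_0_mono: "(pmap ^^ m) x = 0 \<Longrightarrow> m \<le> n \<Longrightarrow> (pmap ^^ n) x = 0"
  by (metis comp_apply funpow_add le_add_diff_inverse2 pmap_pow_0)

lemma pmap_pow_scale: "(pmap ^^ n) (scale a x) = scale (a ^ (CHAR('k) ^ n)) ((pmap ^^ n) x)"
  by (induction n) (auto simp: pmap_scale mult.commute simp flip: power_mult)

text \<open>A single application of the pencil already kills \<open>[:x:]\<close>, since
  \<open>[x, x] = [y, x] = 0\<close>, and \<open>CHAR('k) - 1\<close> is at least 1. Hence
  \<open>pmap\<close> is additive on commuting elements.\<close>

lemma jacobson_term_eq_0:
  assumes "bracket x y = 0"
  shows "jacobson_term i x y = 0"
proof -
  have "(ad_pencil x y ^^ Suc k) [:x:] = 0" for k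
    by (induction k)
      (use assms in \<open>auto simp: ad_pencil_def map_poly_pCons bracket_self bracket_eq_0_commute\<close>)
  moreover have "CHAR('k) - 1 = Suc (CHAR('k) - 2)"
    using CHAR_ge_2 by linarith
  ultimately show ?thesis
    by (simp add: jacobson_term_def del: funpow.simps)
qed

lemma pmap_add_commuting: "bracket x y = 0 \<Longrightarrow> pmap (x + y) = pmap x + pmap y"
  by (simp add: pmap_add jacobson_term_eq_0)

lemma bracket_pmap_eq_0:
  assumes "bracket x y = 0"
  shows "bracket (pmap x) y = 0"
proof -
  have "(bracket x ^^ Suc k) y = 0" for k
    by (induction k) (use assms in auto)
  then show ?thesis
    using char_pos by (metis bracket_pmap gr0_conv_Suc)
qed

lemma bracket_pmap_pow_eq_0: "bracket x y = 0 \<Longrightarrow> bracket ((pmap ^^ m) x) ((pmap ^^ n) y) = 0"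
proof -
  have *: "bracket ((pmap ^^ m) x) y = 0" if "bracket x y = 0" for x y m
    by (induction m) (use that bracket_pmap_eq_0 in auto)
  then show "bracket x y = 0 \<Longrightarrow> bracket ((pmap ^^ m) x) ((pmap ^^ n) y) = 0"
    by (metis bracket_eq_0_commute)
qed

lemma pmap_pow_add_commuting:
  "bracket x y = 0 \<Longrightarrow> (pmap ^^ n) (x + y) = (pmap ^^ n) x + (pmap ^^ n) y"
  by (induction n) (auto simp: pmap_add_commuting bracket_pmap_pow_eq_0)

lemma pmap_centre: "z \<in> centre \<Longrightarrow> pmap z \<in> centre"
  by (simp add: centre_def bracket_pmap_eq_0)

lemma pmap_pow_centre: "z \<in> centre \<Longrightarrow> (pmap ^^ n) z \<in> centre"
  by (induction n) (auto simp: pmap_centre)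

lemma bracket_pmap_pow: "bracket ((pmap ^^ n) x) y = (bracket x ^^ (CHAR('k) ^ n)) y"
proof (induction n arbitrary: y)
  case (Suc n)
  have "bracket ((pmap ^^ n) x) = bracket x ^^ (CHAR('k) ^ n)"
    using Suc by blast
  then show ?case
    by (simp add: bracket_pmap funpow_mult mult.commute)
qed auto

text \<open>The adjoint map of an iterated \<open>p\<close>-power is a power of \<open>ad x\<close>.
  It vanishes once its exponent reaches the length of the lower central series, so one
  \<open>N\<close> serves all \<open>x\<close>; that length itself will do, because
  \<open>p ^ n\<close> is at least \<open>n\<close>.\<close>

lemma high_pmap_pow_central:
  assumes lie_nilpotent
  shows "\<exists>N. \<forall>x. (pmap ^^ N) x \<in> centre"
proof -
  obtain n where n: "lower_central n = {0}"
    using assms unfolding lie_nilpotent_def by blast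
  have "n \<le> CHAR('k) ^ n"
    using CHAR_ge_2 by (meson less_imp_le_nat less_exp order_trans power_mono zero_le)
  then show ?thesis
    using ad_pow_eq_0[OF n] by (auto simp: centre_def bracket_pmap_pow)
qed

section \<open>Restricted subalgebras generated by one element\<close>

definition cyc :: "'v \<Rightarrow> 'v set" where
  "cyc x = span (range (\<lambda>i. (pmap ^^ i) x))"

lemma subspace_cyc: "subspace (cyc x)"
  by (simp add: cyc_def)

lemma pmap_pow_in_cyc: "(pmap ^^ i) x \<in> cyc x"
  by (auto simp: cyc_def intro: span_base)

lemma self_in_cyc: "x \<in> cyc x"
  using pmap_pow_in_cyc[of 0] by simp

text \<open>Stated for \<open>pmap\<close>-stable subspaces so that it applies to the centre and to
  images under powers of \<open>pmap\<close> as well as to restricted subalgebras.\<close>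

lemma cyc_minimal:
  assumes "subspace W" "\<And>w. w \<in> W \<Longrightarrow> pmap w \<in> W" "x \<in> W"
  shows "cyc x \<subseteq> W"
proof -
  have "(pmap ^^ i) x \<in> W" for i
    by (induction i) (use assms in auto)
  then show ?thesis
    unfolding cyc_def using assms(1) by (intro span_minimal) auto
qed

lemma bracket_cyc_eq_0:
  assumes "bracket x y = 0" "u \<in> cyc x" "v \<in> cyc y"
  shows "bracket u v = 0"
proof -
  have "bracket w v = 0" if "w \<in> range (\<lambda>i. (pmap ^^ i) x)" for w
    using assms(3) unfolding cyc_def
    by (induction rule: span_induct)
      (use that assms(1) in \<open>auto simp: subspace_def bracket_add_right bracket_scale_right
        intro: bracket_pmap_pow_eq_0\<close>)
  then have "cyc x \<subseteq> {w. bracket w v = 0}"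
    unfolding cyc_def
    by (intro span_minimal) (auto simp: subspace_def bracket_add_left bracket_scale_left)
  then show ?thesis
    using assms(2) by blast
qed

lemma cyc_abelian: "u \<in> cyc x \<Longrightarrow> v \<in> cyc x \<Longrightarrow> bracket u v = 0"
  by (rule bracket_cyc_eq_0[OF bracket_self])

lemma pmap_in_cyc_pmap:
  assumes "u \<in> cyc x"
  shows "pmap u \<in> cyc (pmap x)"
proof -
  \<comment> \<open>Membership in \<open>cyc x\<close> is kept in the set on the right because
    additivity of \<open>pmap\<close> there comes from \<open>cyc_abelian\<close>.\<close>
  have "cyc x \<subseteq> {u \<in> cyc x. pmap u \<in> cyc (pmap x)}"
    unfolding cyc_def[of x]
  proof (rule span_minimal)
    show "range (\<lambda>i. (pmap ^^ i) x) \<subseteq> {u \<in> span (range (\<lambda>i. (pmap ^^ i) x)). pmap u \<in> cyc (pmap x)}"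
      using pmap_pow_in_cyc[of _ "pmap x"] by (auto intro: span_base simp: funpow_swap1)
    show "subspace {u \<in> span (range (\<lambda>i. (pmap ^^ i) x)). pmap u \<in> cyc (pmap x)}"
      using subspace_cyc[of "pmap x"] subspace_cyc[of x] cyc_abelian[of _ x]
      unfolding cyc_def[of x, symmetric]
      by (auto simp: subspace_def pmap_scale pmap_add_commuting)
  qed
  then show ?thesis
    using assms by blast
qed

lemma cyc_pmap_subset: "cyc (pmap x) \<subseteq> cyc x"
proof -
  have "(pmap ^^ i) (pmap x) = (pmap ^^ Suc i) x" for i
    by (simp add: funpow_swap1)
  then show ?thesis
    unfolding cyc_def by (intro span_mono) blast
qed

lemma cyc_pmap_pow_subset: "cyc ((pmap ^^ n) x) \<subseteq> cyc x"
  by (induction n) (use cyc_pmap_subset in auto)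

lemma pmap_in_cyc: "u \<in> cyc x \<Longrightarrow> pmap u \<in> cyc x"
  using pmap_in_cyc_pmap cyc_pmap_subset by blast

text \<open>The iterated \<open>p\<close>-powers of \<open>x\<close> commute, so their linear span
  is closed under brackets trivially and under \<open>pmap\<close> by additivity. Thus the span is
  all of \<open>generated {x}\<close>.\<close>

lemma restricted_subalgebra_cyc: "restricted_subalgebra (cyc x)"
  by (simp add: restricted_subalgebra_def subspace_cyc pmap_in_cyc cyc_abelian subspace_0)

lemma cyc_subset:
  "restricted_subalgebra H \<Longrightarrow> x \<in> H \<Longrightarrow> cyc x \<subseteq> H"
  unfolding restricted_subalgebra_def by (intro cyc_minimal) auto

lemma generated_singleton: "generated {x} = cyc x"
  unfolding generated_def
  by (rule hull_unique) (auto simp: self_in_cyc restricted_subalgebra_cyc dest: cyc_subset)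

section \<open>Semisimple and \<open>p\<close>-nilpotent elements\<close>

lemma semisimple_iff: "semisimple x \<longleftrightarrow> x \<in> cyc (pmap x)"
  by (simp add: semisimple_def generated_singleton)

text \<open>Applying \<open>pmap\<close> to the induction hypothesis puts \<open>pmap x\<close> into
  the next \<open>cyc\<close>, and semisimplicity then brings \<open>x\<close> along.\<close>

lemma semisimple_in_cyc_pow:
  assumes "semisimple x"
  shows "x \<in> cyc ((pmap ^^ n) x)"
proof (induction n)
  case 0
  then show ?case by (simp add: self_in_cyc)
next
  case (Suc n)
  have "x \<in> cyc (pmap x)"
    using assms by (simp add: semisimple_iff)
  also have "cyc (pmap x) \<subseteq> cyc ((pmap ^^ Suc n) x)"
    using pmap_in_cyc_pmap[OF Suc] restricted_subalgebra_cyc by (simp add: cyc_subset)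
  finally show ?case .
qed

lemma semisimple_central:
  assumes lie_nilpotent "semisimple x"
  shows "x \<in> centre"
proof -
  obtain N where "(pmap ^^ N) x \<in> centre"
    using high_pmap_pow_central assms(1) by blast
  then have "cyc ((pmap ^^ N) x) \<subseteq> centre"
    by (intro cyc_minimal subspace_centre pmap_centre)
  then show ?thesis
    using semisimple_in_cyc_pow[OF assms(2)] by blast
qed

text \<open>The subspaces \<open>cyc ((pmap ^^ n) x)\<close> decrease, and equality of two
  successive ones makes the generator of the larger semisimple.\<close>

lemma high_pmap_pow_semisimple:
  assumes "finite_dimensional_vector_space scale B"
  shows "\<exists>N. semisimple ((pmap ^^ N) x)"
proof -
  have "\<exists>N. \<forall>n\<ge>N. cyc ((pmap ^^ n) x) = cyc ((pmap ^^ N) x)"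
    using assms
    by (rule decreasing_subspaces_stabilize)
      (auto simp: subspace_cyc dest: subsetD[OF cyc_pmap_subset])
  then obtain N where "cyc ((pmap ^^ Suc N) x) = cyc ((pmap ^^ N) x)"
    by (meson le_Suc_eq order_refl)
  then have "semisimple ((pmap ^^ N) x)"
    using self_in_cyc[of "(pmap ^^ N) x"] by (simp add: semisimple_iff)
  then show ?thesis ..
qed

text \<open>The exponent may depend on \<open>x\<close>. A uniform one, as
  \<open>p_nilpotent\<close> demands, is found in \<open>direct_sum_if_quasi_ideals\<close>.\<close>

definition p_nil :: "'v set" where
  "p_nil = {x. \<exists>n. (pmap ^^ n) x = 0}"

lemma p_nil_add_commuting:
  assumes "x \<in> p_nil" "y \<in> p_nil" "bracket x y = 0"
  shows "x + y \<in> p_nil"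
proof -
  obtain m n where "(pmap ^^ m) x = 0" "(pmap ^^ n) y = 0"
    using assms unfolding p_nil_def by blast
  then have "(pmap ^^ max m n) (x + y) = 0"
    using assms(3) by (simp add: pmap_pow_add_commuting pmap_pow_eq_0_mono)
  then show ?thesis
    unfolding p_nil_def by blast
qed

lemma p_nil_scale: "x \<in> p_nil \<Longrightarrow> scale a x \<in> p_nil"
  by (auto simp: p_nil_def pmap_pow_scale)

lemma zero_in_p_nil: "0 \<in> p_nil"
  by (simp add: p_nil_def)

lemma pmap_p_nil: "x \<in> p_nil \<Longrightarrow> pmap x \<in> p_nil"
proof -
  assume "x \<in> p_nil"
  then obtain n where "(pmap ^^ n) x = 0"
    unfolding p_nil_def by blast
  then have "(pmap ^^ n) (pmap x) = 0"
    by (simp add: funpow_swap1[symmetric])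
  then show ?thesis
    unfolding p_nil_def by blast
qed

lemma pmap_pow_p_nil: "x \<in> p_nil \<Longrightarrow> (pmap ^^ n) x \<in> p_nil"
  by (induction n) (auto simp: pmap_p_nil)

lemma p_nil_if_pmap_pow: "(pmap ^^ n) x \<in> p_nil \<Longrightarrow> x \<in> p_nil"
  unfolding p_nil_def by clarsimp (metis comp_apply funpow_add)

lemma cyc_subset_p_nil:
  assumes "x \<in> p_nil"
  shows "cyc x \<subseteq> p_nil"
proof -
  \<comment> \<open>At this point \<open>p_nil\<close> is closed only under sums of commuting
    elements; intersecting with the abelian \<open>cyc x\<close> gives a subspace.\<close>
  have "cyc x \<subseteq> cyc x \<inter> p_nil"
    using assms subspace_cyc[of x]
    by (intro cyc_minimal)
      (auto simp: subspace_def zero_in_p_nil p_nil_scale pmap_p_nil pmap_in_cyc self_in_cyc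
        intro!: p_nil_add_commuting dest: cyc_abelian)
  then show ?thesis by blast
qed

section \<open>Sums of restricted subalgebras and closure of \<open>p_nil\<close>\<close>

lemma restricted_subalgebra_plus:
  assumes A: "restricted_subalgebra A" and B: "restricted_subalgebra B"
    and AB: "lie_product A B \<subseteq> A + B"
  shows "restricted_subalgebra (A + B)"
proof -
  have sub: "subspace (A + B)"
    using A B by (simp add: restricted_subalgebra_def subspace_set_plus)
  have inA: "a \<in> A + B" if "a \<in> A" for a
    using set_plus_intro[OF that, of 0 B] B by (simp add: restricted_subalgebra_def subspace_0)
  have inB: "b \<in> A + B" if "b \<in> B" for b
    using set_plus_intro[OF _ that, of 0 A] A by (simp add: restricted_subalgebra_def subspace_0)
  have ab: "bracket a b \<in> A + B" if "a \<in> A" "b \<in> B" for a b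
    using AB bracket_in_lie_product that by blast
  have ba: "bracket b a \<in> A + B" if "a \<in> A" "b \<in> B" for a b
    using ab[OF that] sub by (simp add: bracket_anticomm[of b a] subspace_neg)
  have br: "bracket h k \<in> A + B" if "h \<in> A + B" "k \<in> A + B" for h k
  proof -
    obtain a b a' b' where *: "h = a + b" "k = a' + b'" "a \<in> A" "a' \<in> A" "b \<in> B" "b' \<in> B"
      using \<open>h \<in> A + B\<close> \<open>k \<in> A + B\<close> by (auto elim!: set_plus_elim)
    then have "bracket a a' \<in> A + B" "bracket b b' \<in> A + B"
      using A B inA inB by (auto simp: restricted_subalgebra_def)
    then show ?thesis
      using * ab ba sub by (auto simp: bracket_add_left bracket_add_right intro!: subspace_add)
  qed
  have "pmap h \<in> A + B" if h: "h \<in> A + B" for h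
  proof -
    obtain a b where *: "h = a + b" "a \<in> A" "b \<in> B"
      using h by (auto elim!: set_plus_elim)
    \<comment> \<open>The correction terms in \<open>pmap (a + b)\<close> are absorbed by the
      closure under brackets from \<open>br\<close>.\<close>
    then have "jacobson_term i a b \<in> A + B" for i
      using jacobson_term_in[OF sub br] inA inB by blast
    moreover have "pmap a \<in> A + B" "pmap b \<in> A + B"
      using * A B inA inB by (auto simp: restricted_subalgebra_def)
    ultimately show ?thesis
      using sub *(1) by (auto simp: pmap_add intro!: subspace_add subspace_sum)
  qed
  then show ?thesis
    using sub br unfolding restricted_subalgebra_def by blast
qed

text \<open>\<open>x\<close> and \<open>y\<close> need not commute, so their sum is out of reach of
  \<open>p_nil_add_commuting\<close>. The components of a central \<open>p\<close>-power of
  \<open>h\<close> do commute, and \<open>p\<close>-nilpotency passes back from that power to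
  \<open>h\<close>.\<close>

lemma cyc_plus_subset_p_nil:
  assumes "finite_dimensional_vector_space scale B" lie_nilpotent
    and H: "restricted_subalgebra (cyc x + cyc y)" and "x \<in> p_nil" "y \<in> p_nil"
  shows "cyc x + cyc y \<subseteq> p_nil"
proof
  fix h assume h: "h \<in> cyc x + cyc y"
  obtain N where ss: "semisimple ((pmap ^^ N) h)"
    using high_pmap_pow_semisimple assms(1) by blast
  define t where "t = (pmap ^^ N) h"
  have "t \<in> cyc x + cyc y"
    using cyc_subset[OF H h] pmap_pow_in_cyc unfolding t_def by blast
  then obtain u v where t: "t = u + v" and uv: "u \<in> cyc x" "v \<in> cyc y"
    by (auto elim!: set_plus_elim)
  have "bracket u t = 0"
    using semisimple_central[OF assms(2) ss] by (simp add: t_def bracket_centre_right)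
  then have "bracket u v = 0"
    by (simp add: t bracket_add_right bracket_self)
  then have "t \<in> p_nil"
    unfolding t using uv assms(4,5) cyc_subset_p_nil by (intro p_nil_add_commuting) blast+
  then show "h \<in> p_nil"
    unfolding t_def by (rule p_nil_if_pmap_pow)
qed

text \<open>The quasi-ideal condition makes \<open>cyc x + cyc y\<close> a restricted subalgebra
  inside \<open>p_nil\<close>; it contains both \<open>x + y\<close> and
  \<open>[x, y]\<close>.\<close>

lemma restricted_subalgebra_p_nil:
  assumes "finite_dimensional_vector_space scale B" lie_nilpotent
    and q: "\<And>H. restricted_subalgebra H \<Longrightarrow> restricted_quasi_ideal UNIV H"
  shows "restricted_subalgebra p_nil"
proof -
  have *: "x + y \<in> p_nil \<and> bracket x y \<in> p_nil" if xy: "x \<in> p_nil" "y \<in> p_nil" for x y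
  proof -
    have "lie_product (cyc x) (cyc y) \<subseteq> cyc x + cyc y"
      using q[OF restricted_subalgebra_cyc] restricted_subalgebra_cyc
      unfolding restricted_quasi_ideal_def by blast
    moreover from this have "cyc x + cyc y \<subseteq> p_nil"
      using assms(1,2) xy
      by (intro cyc_plus_subset_p_nil restricted_subalgebra_plus restricted_subalgebra_cyc)
    ultimately show ?thesis
      using bracket_in_lie_product[OF self_in_cyc self_in_cyc, of x y]
        set_plus_intro[OF self_in_cyc self_in_cyc, of x y] by blast
  qed
  then show ?thesis
    by (auto simp: restricted_subalgebra_def subspace_def zero_in_p_nil p_nil_scale pmap_p_nil)
qed

section \<open>Perfect fields and the Fitting decomposition of the centre\<close>

lemma ex_pow_root:
  assumes "perfect_field TYPE('k)"
  shows "\<exists>b. b ^ (CHAR('k) ^ n) = (a :: 'k)"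
proof (induction n arbitrary: a)
  case (Suc n)
  obtain b where "a = b ^ CHAR('k)"
    using assms char_pos unfolding perfect_field_def surj_def by auto
  moreover obtain c where "c ^ (CHAR('k) ^ n) = b"
    using Suc by blast
  ultimately show ?case
    by (metis power_Suc2 power_mult)
qed auto

text \<open>On an abelian subspace \<open>pmap ^^ n\<close> is additive and semilinear for the
  \<open>n\<close>-th power of Frobenius. Roots of scalars make its image closed under
  scaling.\<close>

lemma subspace_pmap_pow_image:
  assumes "perfect_field TYPE('k)" "subspace A" "\<And>u v. u \<in> A \<Longrightarrow> v \<in> A \<Longrightarrow> bracket u v = 0"
  shows "subspace ((pmap ^^ n) ` A)"
  unfolding subspace_def
proof (intro conjI ballI allI)
  show "0 \<in> (pmap ^^ n) ` A"
    using subspace_0[OF assms(2)] by (metis image_eqI pmap_pow_0)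
next
  fix x y assume "x \<in> (pmap ^^ n) ` A" "y \<in> (pmap ^^ n) ` A"
  then show "x + y \<in> (pmap ^^ n) ` A"
    using assms(2,3) by (auto simp: subspace_add simp flip: pmap_pow_add_commuting)
next
  fix a :: 'k and x assume "x \<in> (pmap ^^ n) ` A"
  then obtain u where u: "u \<in> A" "x = (pmap ^^ n) u" by blast
  obtain b where "b ^ (CHAR('k) ^ n) = a"
    using ex_pow_root[OF assms(1)] by blast
  then have "scale a x = (pmap ^^ n) (scale b u)"
    by (simp add: u pmap_pow_scale)
  then show "scale a x \<in> (pmap ^^ n) ` A"
    using u(1) assms(2) by (simp add: subspace_scale)
qed

text \<open>Lets a relation between \<open>p\<close>-powers be lifted: an element of
  \<open>cyc ((pmap ^^ n) x)\<close> is the \<open>p\<close>-power of an element of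
  \<open>cyc x\<close>. This is how semisimplicity descends from a power of \<open>s\<close> to
  \<open>s\<close> below.\<close>

lemma cyc_pmap_pow_subset_image:
  assumes "perfect_field TYPE('k)"
  shows "cyc ((pmap ^^ n) x) \<subseteq> (pmap ^^ n) ` cyc x"
proof (rule cyc_minimal)
  show "subspace ((pmap ^^ n) ` cyc x)"
    using assms by (intro subspace_pmap_pow_image subspace_cyc) (auto dest: cyc_abelian)
  show "pmap w \<in> (pmap ^^ n) ` cyc x" if "w \<in> (pmap ^^ n) ` cyc x" for w
    using that by (auto simp: funpow_swap1 intro: pmap_in_cyc)
qed (simp add: self_in_cyc)

text \<open>The images of \<open>centre\<close> under powers of \<open>pmap\<close> decrease and the
  kernels increase. Both are chains of subspaces, and \<open>N\<close> is the larger of the two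
  points of stabilization.\<close>

lemma centre_fitting:
  assumes "finite_dimensional_vector_space scale B" "perfect_field TYPE('k)"
  shows "\<exists>N. (\<forall>n\<ge>N. (pmap ^^ n) ` centre = (pmap ^^ N) ` centre) \<and>
             (\<forall>z\<in>centre \<inter> p_nil. (pmap ^^ N) z = 0)"
proof -
  have "\<exists>N. \<forall>n\<ge>N. (pmap ^^ n) ` centre = (pmap ^^ N) ` centre"
    using assms(1)
  proof (rule decreasing_subspaces_stabilize)
    show "subspace ((pmap ^^ n) ` centre)" for n
      using assms(2) by (intro subspace_pmap_pow_image subspace_centre bracket_centre_left)
    show "(pmap ^^ Suc n) ` centre \<subseteq> (pmap ^^ n) ` centre" for n
      by (auto simp: funpow_swap1 intro: pmap_centre)
  qed
  then obtain M where M: "\<And>n. n \<ge> M \<Longrightarrow> (pmap ^^ n) ` centre = (pmap ^^ M) ` centre"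
    by blast
  have "\<exists>N. \<forall>n\<ge>N. {z \<in> centre. (pmap ^^ n) z = 0} = {z \<in> centre. (pmap ^^ N) z = 0}"
    using assms(1)
  proof (rule increasing_subspaces_stabilize)
    show "subspace {z \<in> centre. (pmap ^^ n) z = 0}" for n
      using subspace_centre
      by (auto simp: subspace_def pmap_pow_scale pmap_pow_add_commuting bracket_centre_left)
  qed auto
  then obtain K where
    K: "\<And>n. n \<ge> K \<Longrightarrow> {z \<in> centre. (pmap ^^ n) z = 0} = {z \<in> centre. (pmap ^^ K) z = 0}"
    by blast
  have "(pmap ^^ max M K) z = 0" if z: "z \<in> centre" "z \<in> p_nil" for z
  proof -
    obtain n where "(pmap ^^ n) z = 0"
      using z unfolding p_nil_def by blast
    then have "(pmap ^^ max n K) z = 0"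
      by (rule pmap_pow_eq_0_mono) simp
    then have "(pmap ^^ K) z = 0"
      using K[of "max n K"] z(1) by auto
    then show ?thesis
      by (rule pmap_pow_eq_0_mono) simp
  qed
  moreover have "(pmap ^^ n) ` centre = (pmap ^^ max M K) ` centre" if "n \<ge> max M K" for n
    using M[of n] M[of "max M K"] that by simp
  ultimately show ?thesis by blast
qed

section \<open>The decomposition and its converse\<close>

lemma direct_sum_if_quasi_ideals:
  assumes fd: "finite_dimensional_vector_space scale B" and nil: lie_nilpotent
    and perfect: "perfect_field TYPE('k)"
    and q: "\<And>H. restricted_subalgebra H \<Longrightarrow> restricted_quasi_ideal UNIV H"
  shows "\<exists>S. lie_direct_sum UNIV S p_nil \<and> toral_ideal S \<and> p_nilpotent_ideal p_nil"
proof -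
  obtain N where N: "\<And>n. n \<ge> N \<Longrightarrow> (pmap ^^ n) ` centre = (pmap ^^ N) ` centre"
    and N0: "\<And>z. z \<in> centre \<Longrightarrow> z \<in> p_nil \<Longrightarrow> (pmap ^^ N) z = 0"
    using centre_fitting[OF fd perfect] by blast
  obtain M where M: "\<And>x. (pmap ^^ M) x \<in> centre"
    using high_pmap_pow_central[OF nil] by blast
  \<comment> \<open>The stable image, i.e. the Fitting component of \<open>centre\<close> on which
    \<open>pmap\<close> is bijective; \<open>S_image\<close> and \<open>S_nil\<close> give the two
    halves.\<close>
  define S where "S = (pmap ^^ N) ` centre"
  have subS: "subspace S"
    unfolding S_def using perfect
    by (intro subspace_pmap_pow_image subspace_centre bracket_centre_left)
  have S_centre: "S \<subseteq> centre"
    unfolding S_def using pmap_pow_centre by blast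
  have S_image: "(pmap ^^ n) ` S = S" for n
    unfolding S_def using N[of "n + N"] by (simp add: funpow_add image_comp)
  have S_pmap: "pmap s \<in> S" if "s \<in> S" for s
    using S_image[of 1] that by auto
  have S_nil: "s = 0" if "s \<in> S" "s \<in> p_nil" for s
    using that N0 p_nil_if_pmap_pow unfolding S_def by blast
  have P: "restricted_subalgebra p_nil"
    using restricted_subalgebra_p_nil[OF fd nil q] .
  \<comment> \<open>After \<open>M\<close> steps \<open>x\<close> becomes central and after
    \<open>N\<close> more it lies in \<open>S\<close>. As \<open>pmap ^^ (N + M)\<close> maps
    \<open>S\<close> onto itself, some \<open>s\<close> in \<open>S\<close> has the same power as
    \<open>x\<close>; being central, it can be subtracted before taking powers.\<close>
  have decomp: "\<exists>s\<in>S. x - s \<in> p_nil" for x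
  proof -
    have "(pmap ^^ (N + M)) x \<in> S"
      unfolding S_def using M[of x] by (simp add: funpow_add)
    then obtain s where s: "s \<in> S" "(pmap ^^ (N + M)) x = (pmap ^^ (N + M)) s"
      using S_image[of "N + M"] by (metis imageE)
    have "bracket (x - s) s = 0"
      using s(1) S_centre by (auto intro: bracket_centre_right)
    from pmap_pow_add_commuting[OF this, of "N + M"] have "(pmap ^^ (N + M)) (x - s) = 0"
      using s(2) by simp
    then show ?thesis
      using s(1) unfolding p_nil_def by blast
  qed
  \<comment> \<open>A high power of \<open>s\<close> is semisimple, so it equals the same power of
    some \<open>w\<close> in \<open>cyc (pmap s)\<close>. Both \<open>s\<close> and \<open>w\<close>
    lie in \<open>S\<close>, where \<open>S_nil\<close> forces \<open>s = w\<close>.\<close>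
  have ss: "semisimple s" if s: "s \<in> S" for s
  proof -
    obtain m where "semisimple ((pmap ^^ m) s)"
      using high_pmap_pow_semisimple[OF fd] by blast
    then have "(pmap ^^ m) s \<in> cyc ((pmap ^^ m) (pmap s))"
      by (simp add: semisimple_iff funpow_swap1)
    then obtain w where w: "w \<in> cyc (pmap s)" "(pmap ^^ m) s = (pmap ^^ m) w"
      using cyc_pmap_pow_subset_image[OF perfect] by blast
    have wS: "w \<in> S"
      using cyc_minimal[OF subS S_pmap, of "pmap s"] w(1) S_pmap[OF s] by blast
    have "bracket (s - w) w = 0"
      using wS S_centre by (auto intro: bracket_centre_right)
    from pmap_pow_add_commuting[OF this, of m] have "(pmap ^^ m) (s - w) = 0"
      using w(2) by simp
    then have "s - w = 0"
      using S_nil[of "s - w"] subspace_diff[OF subS s wS] unfolding p_nil_def by blast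
    then show ?thesis
      using w(1) by (simp add: semisimple_iff)
  qed
  have "toral_ideal S"
    unfolding toral_ideal_def restricted_ideal_def torus_def restricted_subalgebra_def
      lie_product_eq_0_iff
    using subS S_pmap S_centre ss subspace_0[OF subS]
    by (auto simp: subset_iff bracket_centre_left bracket_centre_right)
  moreover have "UNIV = S + p_nil"
  proof -
    have "x \<in> S + p_nil" for x
      using decomp[of x] set_plus_intro[of _ S "x - _" p_nil] by fastforce
    then show ?thesis by blast
  qed
  moreover have "S \<inter> p_nil = {0}"
    using S_nil subspace_0[OF subS] zero_in_p_nil by auto
  moreover have "\<forall>x. \<forall>y\<in>p_nil. bracket x y \<in> p_nil"
  proof (intro allI ballI)
    fix x y assume y: "y \<in> p_nil"
    obtain s where s: "s \<in> S" "x - s \<in> p_nil"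
      using decomp by blast
    have "bracket x y = bracket (x - s) y + bracket s y"
      by (simp flip: bracket_add_left)
    also have "bracket s y = 0"
      using s(1) S_centre by (auto intro: bracket_centre_left)
    finally show "bracket x y \<in> p_nil"
      using P s(2) y by (simp add: restricted_subalgebra_def)
  qed
  \<comment> \<open>\<open>M\<close> steps lead into the centre and \<open>N\<close> more kill
    central \<open>p\<close>-nilpotent elements; \<open>Suc\<close> makes the exponent
    positive.\<close>
  moreover have "\<exists>n>0. \<forall>x\<in>p_nil. (pmap ^^ n) x = 0"
    using N0[OF M pmap_pow_p_nil] by (intro exI[of _ "Suc (N + M)"]) (simp add: funpow_add)
  moreover have "\<forall>a\<in>S. \<forall>b\<in>p_nil. bracket a b = 0"
    using S_centre bracket_centre_left by blast
  ultimately show ?thesis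
    using P subS
    unfolding lie_direct_sum_def p_nilpotent_ideal_def p_nilpotent_def restricted_ideal_def
      lie_product_eq_0_iff restricted_subalgebra_def
    by (intro exI[of _ S] conjI) blast+
qed

text \<open>A high \<open>p\<close>-power of \<open>s + x\<close> erases \<open>x\<close> and leaves
  a power of \<open>s\<close>, which still generates \<open>s\<close>.\<close>

lemma semisimple_part_in_cyc:
  assumes "semisimple s" "(pmap ^^ n) x = 0" "bracket s x = 0"
  shows "s \<in> cyc (s + x)"
proof -
  have "(pmap ^^ n) (s + x) = (pmap ^^ n) s"
    using assms by (simp add: pmap_pow_add_commuting)
  then show ?thesis
    using semisimple_in_cyc_pow[OF assms(1), of n] cyc_pmap_pow_subset[of n "s + x"] by auto
qed

lemma quasi_ideals_if_direct_sum:
  assumes sum: "lie_direct_sum UNIV S P" and S: "toral_ideal S" and P: "p_nilpotent_ideal P"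
    and q: "\<And>H. restricted_subalgebra H \<Longrightarrow> H \<subseteq> P \<Longrightarrow> restricted_quasi_ideal P H"
    and H: "restricted_subalgebra H"
  shows "restricted_quasi_ideal UNIV H"
proof -
  have SP: "bracket s x = 0" if "s \<in> S" "x \<in> P" for s x
    using that sum by (auto simp: lie_direct_sum_def lie_product_eq_0_iff)
  have SS: "bracket s t = 0" if "s \<in> S" "t \<in> S" for s t
    using that S by (auto simp: toral_ideal_def torus_def lie_product_eq_0_iff)
  have P': "restricted_subalgebra P"
    using P by (simp add: p_nilpotent_ideal_def p_nilpotent_def)
  \<comment> \<open>Every restricted subalgebra contains the components of its elements: the
    semisimple one by \<open>semisimple_part_in_cyc\<close>, the other by subtraction.\<close>
  have split: "\<exists>s\<in>S. \<exists>x\<in>P \<inter> K. h = s + x" if K: "restricted_subalgebra K" "h \<in> K" for K h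
  proof -
    obtain s x where sx: "s \<in> S" "x \<in> P" "h = s + x"
      using sum by (metis UNIV_I lie_direct_sum_def set_plus_elim)
    obtain n where "(pmap ^^ n) x = 0"
      using P sx(2) unfolding p_nilpotent_ideal_def p_nilpotent_def by blast
    moreover have "semisimple s"
      using S sx(1) by (simp add: toral_ideal_def torus_def)
    ultimately have "s \<in> K"
      using semisimple_part_in_cyc[of s n x] SP sx cyc_subset[OF K] by auto
    then have "x \<in> K"
      using K sx(3) subspace_diff[of K h s] by (simp add: restricted_subalgebra_def)
    with sx show ?thesis by blast
  qed
  have "lie_product H K \<subseteq> H + K" if K: "restricted_subalgebra K" for K
  proof -
    have "bracket h k \<in> H + K" if hk: "h \<in> H" "k \<in> K" for h k
    proof -
      obtain s x where sx: "s \<in> S" "x \<in> P" "x \<in> H" "h = s + x"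
        using split[OF H hk(1)] by blast
      obtain t y where ty: "t \<in> S" "y \<in> P" "y \<in> K" "k = t + y"
        using split[OF K hk(2)] by blast
      have "bracket h k = bracket x y"
        using sx ty SP SS bracket_eq_0_commute[OF SP[of t x]]
        by (simp add: bracket_add_left bracket_add_right)
      \<comment> \<open>The hypothesis on \<open>P\<close> is applied to \<open>cyc x\<close> and
        \<open>cyc y\<close>, which lie in \<open>P\<close>, whereas \<open>H\<close> and
        \<open>K\<close> need not.\<close>
      also have "\<dots> \<in> lie_product (cyc x) (cyc y)"
        by (intro bracket_in_lie_product self_in_cyc)
      also have "\<dots> \<subseteq> cyc x + cyc y"
        using q[OF restricted_subalgebra_cyc cyc_subset[OF P' sx(2)]]
          restricted_subalgebra_cyc cyc_subset[OF P' ty(2)]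
        unfolding restricted_quasi_ideal_def by blast
      also have "\<dots> \<subseteq> H + K"
        using H K sx(3) ty(3) by (intro set_plus_mono2 cyc_subset)
      finally show ?thesis .
    qed
    then show ?thesis
      using H K lie_product_subset_iff[OF subspace_set_plus]
      by (simp add: restricted_subalgebra_def)
  qed
  then show ?thesis
    using H by (simp add: restricted_quasi_ideal_def)
qed

text \<open>A smaller ambient \<open>M\<close> leaves fewer subalgebras to test against; this
  carries the condition from the whole algebra to the summand \<open>p_nil\<close>.\<close>

lemma restricted_quasi_ideal_subset:
  "restricted_quasi_ideal UNIV H \<Longrightarrow> H \<subseteq> M \<Longrightarrow> restricted_quasi_ideal M H"
  by (auto simp: restricted_quasi_ideal_def)

end

theorem proposition4p5:
  fixes scale :: "'k::field \<Rightarrow> 'v::ab_group_add \<Rightarrow> 'v"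
    and bracket :: "'v \<Rightarrow> 'v \<Rightarrow> 'v"
    and pmap :: "'v \<Rightarrow> 'v"
  assumes "restricted_lie_algebra scale bracket pmap"
    and "\<exists>B. finite_dimensional_vector_space scale B"
    and "lie_algebra.lie_nilpotent scale bracket"
    and "perfect_field TYPE('k)"
    and "CHAR('k) > 0"
    and "CHAR('k) \<noteq> 2"
  shows "(\<forall>H. restricted_lie_algebra.restricted_subalgebra scale bracket pmap H \<longrightarrow>
             restricted_lie_algebra.restricted_quasi_ideal scale bracket pmap UNIV H)
     \<longleftrightarrow>
         (\<exists>S P. lie_algebra.lie_direct_sum scale bracket UNIV S P \<and>
             restricted_lie_algebra.toral_ideal scale bracket pmap S \<and>
             restricted_lie_algebra.p_nilpotent_ideal scale bracket pmap P \<and>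
             (\<forall>H. restricted_lie_algebra.restricted_subalgebra scale bracket pmap H \<and> H \<subseteq> P \<longrightarrow>
                restricted_lie_algebra.restricted_quasi_ideal scale bracket pmap P H))"
proof -
  interpret restricted_lie_algebra scale bracket pmap by fact
  obtain B where fd: "finite_dimensional_vector_space scale B"
    using assms(2) by blast
  show ?thesis
    using direct_sum_if_quasi_ideals[OF fd assms(3,4)] quasi_ideals_if_direct_sum
      restricted_quasi_ideal_subset by meson
qed

end
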